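(* Let $p$ be a prime and $n$ an integer such that $n\geq 2p\geq 4$. Then every non-linear $p$-constant irreducible character of the symmetric group $\mathbb{S}_n$ has $p$-defect $0$.
   Context: Characters are complex. An element is $p$-singular if its order is divisible by $p$. An irreducible character is $p$-constant if it is constant on the set of $p$-singular elements of the group. An irreducible character $\chi$ of a finite group $G$ has $p$-defect $0$ if $|G|/\chi(1)$ is not divisible by $p$ (equivalently, $\chi$ vanishes at all $p$-singular elements). *)

theory Defs
  imports
    "HOL-Algebra.Sym_Groups"
    "HOL-Algebra.Multiplicative_Group"
    "HOL-Computational_Algebra.Primes"
    "Jordan_Normal_Form.VS_Connect"
begin

definition general_linear_group :: "nat \<Rightarrow> complex mat monoid" where
  "general_linear_group d = units_of (ring_mat TYPE(complex) d ())"

definition matrix_trace :: "'a::comm_monoid_add mat \<Rightarrow> 'a" where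
  "matrix_trace A = (\<Sum>i<dim_row A. A $$ (i, i))"

definition matrix_representation ::
  "('g, 'b) monoid_scheme \<Rightarrow> nat \<Rightarrow> ('g \<Rightarrow> complex mat) \<Rightarrow> bool" where
  "matrix_representation G d \<rho> \<longleftrightarrow> \<rho> \<in> hom G (general_linear_group d)"

definition irreducible_representation ::
  "('g, 'b) monoid_scheme \<Rightarrow> nat \<Rightarrow> ('g \<Rightarrow> complex mat) \<Rightarrow> bool" where
  "irreducible_representation G d \<rho> \<longleftrightarrow>
     matrix_representation G d \<rho> \<and> d \<noteq> 0 \<and>
     (\<forall>W. VectorSpace.subspace class_ring W (module_vec TYPE(complex) d) \<and>
          (\<forall>g \<in> carrier G. \<forall>w \<in> W. \<rho> g *\<^sub>v w \<in> W) \<longrightarrow>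
          W = {0\<^sub>v d} \<or> W = carrier_vec d)"

(* Only the values of \<chi> on carrier G are specified; none of the notions below refers to others. *)
definition irreducible_character ::
  "('g, 'b) monoid_scheme \<Rightarrow> ('g \<Rightarrow> complex) \<Rightarrow> bool" where
  "irreducible_character G \<chi> \<longleftrightarrow>
     (\<exists>d \<rho>. irreducible_representation G d \<rho> \<and>
            (\<forall>g \<in> carrier G. \<chi> g = matrix_trace (\<rho> g)))"

definition linear_character ::
  "('g, 'b) monoid_scheme \<Rightarrow> ('g \<Rightarrow> complex) \<Rightarrow> bool" where
  "linear_character G \<chi> \<longleftrightarrow> irreducible_character G \<chi> \<and> \<chi> \<one>\<^bsub>G\<^esub> = 1"

definition p_singular :: "nat \<Rightarrow> ('g, 'b) monoid_scheme \<Rightarrow> 'g \<Rightarrow> bool" where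
  "p_singular p G x \<longleftrightarrow> x \<in> carrier G \<and> p dvd group.ord G x"

definition p_constant :: "nat \<Rightarrow> ('g, 'b) monoid_scheme \<Rightarrow> ('g \<Rightarrow> complex) \<Rightarrow> bool" where
  "p_constant p G \<chi> \<longleftrightarrow>
     (\<forall>x y. p_singular p G x \<longrightarrow> p_singular p G y \<longrightarrow> \<chi> x = \<chi> y)"

(* For an irreducible character of a finite group the quotient |G| / \<chi>(1) is a
   positive integer; since \<chi> is complex-valued, divisibility by p is expressed by an
   explicit integer cofactor (dvd on the field of complex numbers would be meaningless). *)
definition p_defect_zero :: "nat \<Rightarrow> ('g, 'b) monoid_scheme \<Rightarrow> ('g \<Rightarrow> complex) \<Rightarrow> bool" where
  "p_defect_zero p G \<chi> \<longleftrightarrow>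
     \<not> (\<exists>k::int. of_nat (Coset.order G) / \<chi> \<one>\<^bsub>G\<^esub> = of_nat p * of_int k)"

end

theory Submission
  imports Defs "Jordan_Normal_Form.Spectral_Radius" "HOL-Algebra.Sylow"
begin

text \<open>Let \<open>c\<close> be the value of \<open>\<chi>\<close> on the \<open>p\<close>-singular elements and let \<open>x\<close> be a product of two
  disjoint \<open>p\<close>-cycles. Multiplication by a transposition \<open>t\<close> either leaves one of these cycles
  intact or merges the two into a \<open>2p\<close>-cycle, so \<open>x t\<close> is always \<open>p\<close>-singular. The sum of all
  \<open>\<rho> t\<close>, taken over all ordered pairs \<open>(a, b)\<close> (with \<open>t = 1\<close> if \<open>a = b\<close>), is a scalar \<open>\<lambda>\<close> by Schur's
  lemma; multiplying by \<open>\<rho> x\<close> and taking traces gives \<open>\<lambda> c = N c\<close>, where \<open>N = n\<^sup>2\<close>. If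
  \<open>c \<noteq> 0\<close>, then \<open>\<lambda> = N\<close>, so the traces of the idempotents \<open>(1 - \<rho> t) / 2\<close>, which are natural
  numbers, add up to zero; hence \<open>\<rho>\<close> is trivial on transpositions and \<open>\<chi>\<close> is linear. If \<open>c = 0\<close>,
  then \<open>\<chi>\<close> vanishes on the nonidentity elements of a Sylow \<open>p\<close>-subgroup \<open>P\<close>, and the average of \<open>\<rho>\<close>
  over \<open>P\<close> is an idempotent of trace \<open>\<chi>(1) / |P|\<close>, so that \<open>|P|\<close> divides \<open>\<chi>(1)\<close>.\<close>

section \<open>Traces and sums of matrices\<close>

lemma matrix_trace_mult:
  assumes "A \<in> carrier_mat n m" "B \<in> carrier_mat m n"
  shows "matrix_trace (A * B) = (\<Sum>i<n. \<Sum>k<m. A $$ (i, k) * B $$ (k, i))"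
  using assms by (auto simp: matrix_trace_def scalar_prod_def atLeast0LessThan intro!: sum.cong)

lemma matrix_trace_comm:
  fixes A B :: "'a :: comm_semiring_0 mat"
  assumes "A \<in> carrier_mat n m" "B \<in> carrier_mat m n"
  shows "matrix_trace (A * B) = matrix_trace (B * A)"
  unfolding matrix_trace_mult[OF assms] matrix_trace_mult[OF assms(2,1)]
  by (subst sum.swap) (simp add: mult.commute)

lemma matrix_trace_one [simp]: "matrix_trace (1\<^sub>m n :: 'a :: semiring_1 mat) = of_nat n"
  by (simp add: matrix_trace_def)

lemma matrix_trace_smult:
  fixes A :: "'a :: semiring_0 mat"
  assumes "A \<in> carrier_mat n n"
  shows "matrix_trace (a \<cdot>\<^sub>m A) = a * matrix_trace A"
  using assms by (simp add: matrix_trace_def sum_distrib_left)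

lemma matrix_trace_minus:
  fixes A B :: "'a :: ab_group_add mat"
  assumes "A \<in> carrier_mat n n" "B \<in> carrier_mat n n"
  shows "matrix_trace (A - B) = matrix_trace A - matrix_trace B"
  using assms by (simp add: matrix_trace_def sum_subtractf)

lemma smult_smult_mat: "a \<cdot>\<^sub>m (b \<cdot>\<^sub>m A) = (a * b) \<cdot>\<^sub>m (A :: 'a :: semigroup_mult mat)"
  by (intro eq_matI) (auto simp: mult.assoc)

section \<open>Idempotent matrices and their traces\<close>

text \<open>In the sum for a diagonal entry of \<open>B * B\<close>, every term with
  \<open>k \<noteq> i\<close> has a factor below the diagonal, so the entry equals its own
  square.\<close>

lemma upper_triangular_idempotent_diag:
  fixes B :: "'a :: idom mat"
  assumes B: "B \<in> carrier_mat n n" and ut: "upper_triangular B" and idem: "B * B = B" and i: "i < n"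
  shows "B $$ (i, i) = 0 \<or> B $$ (i, i) = 1"
proof -
  have zero: "B $$ (i, k) * B $$ (k, i) = 0" if "k < n" "k \<noteq> i" for k
    using that i B ut by (cases "k < i") (auto simp: upper_triangular_def)
  have "B $$ (i, i) = (B * B) $$ (i, i)" using idem by simp
  also have "\<dots> = (\<Sum>k<n. B $$ (i, k) * B $$ (k, i))"
    using B i by (auto simp: scalar_prod_def atLeast0LessThan intro!: sum.cong)
  also have "\<dots> = (\<Sum>k<n. if k = i then B $$ (i, i) * B $$ (i, i) else 0)"
    by (rule sum.cong) (auto simp: zero)
  also have "\<dots> = B $$ (i, i) * B $$ (i, i)" using i by simp
  finally have "B $$ (i, i) * (B $$ (i, i) - 1) = 0" by (simp add: algebra_simps)
  thus ?thesis by auto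
qed

text \<open>A strictly upper triangular matrix is nilpotent, while an idempotent equals all its
  positive powers. Powers are replaced here by an induction on the distance from the
  diagonal.\<close>

lemma upper_triangular_idempotent_zero:
  fixes B :: "'a :: semiring_1 mat"
  assumes B: "B \<in> carrier_mat n n" and ut: "upper_triangular B" and idem: "B * B = B"
    and diag: "\<And>i. i < n \<Longrightarrow> B $$ (i, i) = 0"
  shows "B = 0\<^sub>m n n"
proof -
  have "B $$ (i, j) = 0" if "i < n" "j < n" for i j
    using that
  \<comment> \<open>Truncated subtraction puts all entries on or below the diagonal at distance 0,
    so they are covered as well. For \<open>i < k < j\<close> the entry \<open>B $$ (i, k)\<close>
    is closer to the diagonal than \<open>B $$ (i, j)\<close>.\<close>
  proof (induction "j - i" arbitrary: i j rule: less_induct)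
    case less
    have z: "B $$ (i, k) * B $$ (k, j) = 0" if k: "k < n" for k
    proof (cases "k \<le> i")
      case True
      hence "B $$ (i, k) = 0" using less.prems k B ut diag
        by (cases "k = i") (auto simp: upper_triangular_def)
      thus ?thesis by simp
    next
      case False
      show ?thesis
      proof (cases "k < j")
        case True
        with False have "B $$ (i, k) = 0" by (intro less.hyps) (use less.prems k in auto)
        thus ?thesis by simp
      next
        case False
        hence "B $$ (k, j) = 0" using less.prems k B ut diag
          by (cases "k = j") (auto simp: upper_triangular_def)
        thus ?thesis by simp
      qed
    qed
    have "B $$ (i, j) = (B * B) $$ (i, j)" using idem by simp
    also have "\<dots> = (\<Sum>k<n. B $$ (i, k) * B $$ (k, j))"
      using B less.prems by (auto simp: scalar_prod_def atLeast0LessThan intro!: sum.cong)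
    also have "\<dots> = 0" by (rule sum.neutral) (simp add: z)
    finally show ?case .
  qed
  thus ?thesis using B by (intro eq_matI) auto
qed

text \<open>Schur triangularisation makes \<open>A\<close> similar to an upper triangular idempotent
  \<open>B\<close>. Its diagonal consists of zeros and ones, so the trace counts the ones; without
  any, \<open>B\<close> is strictly upper triangular and vanishes.\<close>

lemma idempotent_trace:
  fixes A :: "complex mat"
  assumes A: "A \<in> carrier_mat n n" and idem: "A * A = A"
  obtains k :: nat where "matrix_trace A = of_nat k" "k = 0 \<Longrightarrow> A = 0\<^sub>m n n"
proof -
  obtain es where es: "char_poly A = (\<Prod>a\<leftarrow>es. [:- a, 1:])"
    using char_poly_factorized[OF A] by blast
  obtain B P Q where B: "B \<in> carrier_mat n n" and ut: "upper_triangular B"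
    and sim: "similar_mat_wit A B P Q"
    using schur_decomposition_exists[OF A es] by (auto simp: similar_mat_def)
  note PQ = similar_mat_witD2[OF A sim]
  note QP = similar_mat_witD2[OF B similar_mat_wit_sym[OF sim]]
  have "B * B = Q * A * P * (Q * A * P)" using QP(3) by simp
  also have "\<dots> = Q * A * (P * Q) * A * P" using A PQ(6,7)
    by (simp add: assoc_mult_mat[where ?n\<^sub>1=n and ?n\<^sub>2=n and ?n\<^sub>3=n and ?n\<^sub>4=n])
  also have "\<dots> = Q * (A * A) * P" unfolding PQ(1) using A PQ(6,7)
    by (simp add: assoc_mult_mat[where ?n\<^sub>1=n and ?n\<^sub>2=n and ?n\<^sub>3=n and ?n\<^sub>4=n])
  also have "\<dots> = B" using QP(3) idem by simp
  finally have idemB: "B * B = B" .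
  define I where "I = {i. i < n \<and> B $$ (i, i) = 1}"
  have diag: "B $$ (i, i) = (if i \<in> I then 1 else 0)" if "i < n" for i
    using upper_triangular_idempotent_diag[OF B ut idemB that] that by (auto simp: I_def)
  have fin: "finite I" by (simp add: I_def)
  have "matrix_trace A = matrix_trace (P * (B * Q))"
    unfolding PQ(3)[symmetric] using B PQ by (simp add: assoc_mult_mat[OF PQ(6) B PQ(7)])
  also have "\<dots> = matrix_trace (B * Q * P)"
    using matrix_trace_comm[OF PQ(6), of "B * Q"] B PQ(7) by simp
  also have "B * Q * P = B" using B PQ by (simp add: assoc_mult_mat[OF B PQ(7) PQ(6)])
  also have "matrix_trace B = (\<Sum>i<n. if i \<in> I then 1 else 0)"
    using B by (auto simp: matrix_trace_def diag)
  also have "\<dots> = of_nat (card I)"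
    by (subst sum.If_cases) (auto simp: I_def Int_def conj_commute intro!: arg_cong[where f = card])
  finally have tr: "matrix_trace A = of_nat (card I)" .
  have "A = 0\<^sub>m n n" if "card I = 0"
  proof -
    have "I = {}" using that fin by simp
    hence "B = 0\<^sub>m n n"
      by (intro upper_triangular_idempotent_zero[OF B ut idemB]) (simp add: diag)
    thus ?thesis using PQ by simp
  qed
  thus ?thesis by (rule that[OF tr])
qed

section \<open>Sums of families of square matrices\<close>

text \<open>Matrices of all sizes share one type, so an empty sum has no canonical value; the size
  is therefore an explicit argument.\<close>

definition mat_sum :: "nat \<Rightarrow> 'i set \<Rightarrow> ('i \<Rightarrow> 'a :: comm_monoid_add mat) \<Rightarrow> 'a mat" where
  "mat_sum n S F = mat n n (\<lambda>ij. \<Sum>s\<in>S. F s $$ ij)"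

lemma mat_sum_carrier [simp]: "mat_sum n S F \<in> carrier_mat n n"
  by (simp add: mat_sum_def)

lemma mat_sum_cong:
  "(\<And>s. s \<in> S \<Longrightarrow> F s = G s) \<Longrightarrow> mat_sum n S F = mat_sum n S G"
  by (auto simp: mat_sum_def intro!: eq_matI sum.cong)

lemma mat_sum_reindex:
  "bij_betw h S T \<Longrightarrow> mat_sum n T F = mat_sum n S (\<lambda>s. F (h s))"
  by (auto simp: mat_sum_def sum.reindex_bij_betw intro!: eq_matI sum.reindex_bij_betw[symmetric])

lemma mat_sum_const:
  fixes A :: "'a :: semiring_1 mat"
  assumes "A \<in> carrier_mat n n"
  shows "mat_sum n S (\<lambda>s. A) = of_nat (card S) \<cdot>\<^sub>m A"
  using assms by (auto simp: mat_sum_def)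

lemma matrix_trace_mat_sum:
  assumes "\<And>s. s \<in> S \<Longrightarrow> F s \<in> carrier_mat n n"
  shows "matrix_trace (mat_sum n S F) = (\<Sum>s\<in>S. matrix_trace (F s))"
proof -
  have "matrix_trace (mat_sum n S F) = (\<Sum>i<n. \<Sum>s\<in>S. F s $$ (i, i))"
    by (simp add: matrix_trace_def mat_sum_def)
  also have "\<dots> = (\<Sum>s\<in>S. \<Sum>i<n. F s $$ (i, i))" by (rule sum.swap)
  also have "\<dots> = (\<Sum>s\<in>S. matrix_trace (F s))"
    using assms by (intro sum.cong) (auto simp: matrix_trace_def)
  finally show ?thesis .
qed

lemma mult_mat_sum:
  fixes A :: "'a :: semiring_0 mat"
  assumes A: "A \<in> carrier_mat n n" and F: "\<And>s. s \<in> S \<Longrightarrow> F s \<in> carrier_mat n n"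
  shows "A * mat_sum n S F = mat_sum n S (\<lambda>s. A * F s)"
proof (rule eq_matI)
  fix i j assume "i < dim_row (mat_sum n S (\<lambda>s. A * F s))" "j < dim_col (mat_sum n S (\<lambda>s. A * F s))"
  hence ij: "i < n" "j < n" by (auto simp: mat_sum_def)
  have "(A * mat_sum n S F) $$ (i, j) = (\<Sum>k<n. \<Sum>s\<in>S. A $$ (i, k) * F s $$ (k, j))"
    using A ij by (auto simp: mat_sum_def scalar_prod_def atLeast0LessThan sum_distrib_left intro!: sum.cong)
  also have "\<dots> = (\<Sum>s\<in>S. \<Sum>k<n. A $$ (i, k) * F s $$ (k, j))" by (rule sum.swap)
  also have "\<dots> = (\<Sum>s\<in>S. (A * F s) $$ (i, j))"
    using A F ij by (intro sum.cong) (auto simp: scalar_prod_def atLeast0LessThan dest!: F intro!: sum.cong)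
  finally show "(A * mat_sum n S F) $$ (i, j) = mat_sum n S (\<lambda>s. A * F s) $$ (i, j)"
    using ij by (simp add: mat_sum_def)
qed (use A in \<open>auto simp: mat_sum_def\<close>)

lemma mat_sum_mult:
  fixes A :: "'a :: semiring_0 mat"
  assumes A: "A \<in> carrier_mat n n" and F: "\<And>s. s \<in> S \<Longrightarrow> F s \<in> carrier_mat n n"
  shows "mat_sum n S F * A = mat_sum n S (\<lambda>s. F s * A)"
proof (rule eq_matI)
  fix i j assume "i < dim_row (mat_sum n S (\<lambda>s. F s * A))" "j < dim_col (mat_sum n S (\<lambda>s. F s * A))"
  hence ij: "i < n" "j < n" by (auto simp: mat_sum_def)
  have "(mat_sum n S F * A) $$ (i, j) = (\<Sum>k<n. \<Sum>s\<in>S. F s $$ (i, k) * A $$ (k, j))"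
    using A ij by (auto simp: mat_sum_def scalar_prod_def atLeast0LessThan sum_distrib_right intro!: sum.cong)
  also have "\<dots> = (\<Sum>s\<in>S. \<Sum>k<n. F s $$ (i, k) * A $$ (k, j))" by (rule sum.swap)
  also have "\<dots> = (\<Sum>s\<in>S. (F s * A) $$ (i, j))"
    using A F ij by (intro sum.cong) (auto simp: scalar_prod_def atLeast0LessThan dest!: F intro!: sum.cong)
  finally show "(mat_sum n S F * A) $$ (i, j) = mat_sum n S (\<lambda>s. F s * A) $$ (i, j)"
    using ij by (simp add: mat_sum_def)
qed (use A in \<open>auto simp: mat_sum_def\<close>)

section \<open>Representations\<close>

lemma matrix_representation_carrier:
  assumes "matrix_representation G d \<rho>" "g \<in> carrier G"
  shows "\<rho> g \<in> carrier_mat d d"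
  using assms
  by (auto simp: matrix_representation_def general_linear_group_def hom_def units_of_def Units_def
      ring_mat_simps Pi_def)

lemma matrix_representation_mult:
  assumes "matrix_representation G d \<rho>" "g \<in> carrier G" "h \<in> carrier G"
  shows "\<rho> (g \<otimes>\<^bsub>G\<^esub> h) = \<rho> g * \<rho> h"
  using assms
  by (auto simp: matrix_representation_def general_linear_group_def hom_def units_of_def
      ring_mat_simps)

text \<open>Multiplicativity alone would only make the image of the identity idempotent. It is the
  identity matrix because the target is a group of units.\<close>

lemma matrix_representation_one:
  assumes "group G" "matrix_representation G d \<rho>"
  shows "\<rho> \<one>\<^bsub>G\<^esub> = 1\<^sub>m d"
proof -
  interpret R: ring "ring_mat TYPE(complex) d ()" by (rule ring_mat)
  have "group_hom G (general_linear_group d) \<rho>"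
    using assms R.units_group
    by (simp add: group_hom_def group_hom_axioms_def matrix_representation_def general_linear_group_def)
  from group_hom.hom_one[OF this] show ?thesis
    by (simp add: general_linear_group_def units_of_def ring_mat_simps)
qed

section \<open>Invariant subspaces and Schur's lemma\<close>

lemma subspace_vecI:
  fixes W :: "'a :: field vec set"
  assumes "W \<subseteq> carrier_vec d" "0\<^sub>v d \<in> W"
    "\<And>v w. v \<in> W \<Longrightarrow> w \<in> W \<Longrightarrow> v + w \<in> W" "\<And>a v. v \<in> W \<Longrightarrow> a \<cdot>\<^sub>v v \<in> W"
  shows "VectorSpace.subspace class_ring W (module_vec TYPE('a) d)"
  using assms vec_vs[where ?'a = 'a, of d] vec_module[where ?'a = 'a, of d]
  by (simp add: VectorSpace.subspace_def submodule_def module_vec_simps)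

lemma irreducible_representationD:
  assumes "irreducible_representation G d \<rho>" "W \<subseteq> carrier_vec d" "0\<^sub>v d \<in> W"
    "\<And>v w. v \<in> W \<Longrightarrow> w \<in> W \<Longrightarrow> v + w \<in> W" "\<And>a v. v \<in> W \<Longrightarrow> a \<cdot>\<^sub>v v \<in> W"
    "\<And>g w. g \<in> carrier G \<Longrightarrow> w \<in> W \<Longrightarrow> \<rho> g *\<^sub>v w \<in> W"
  shows "W = {0\<^sub>v d} \<or> W = carrier_vec d"
  using assms(1,6) subspace_vecI[OF assms(2-5)] unfolding irreducible_representation_def by blast

text \<open>An eigenspace \<open>W\<close> of \<open>A\<close> is invariant because \<open>A\<close>
  commutes with the representation. It is nonzero, so by irreducibility it is the whole space, and
  the unit vectors then determine \<open>A\<close> column by column.\<close>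

lemma schur_scalar:
  assumes irr: "irreducible_representation G d \<rho>" and A: "A \<in> carrier_mat d d"
    and comm: "\<And>g. g \<in> carrier G \<Longrightarrow> \<rho> g * A = A * \<rho> g"
  obtains l where "A = l \<cdot>\<^sub>m 1\<^sub>m d"
proof -
  have rep: "matrix_representation G d \<rho>" and d: "d > 0"
    using irr by (auto simp: irreducible_representation_def)
  obtain l v where "eigenvector A v l"
    using spectrum_non_empty[OF A d] unfolding spectrum_def eigenvalue_def by blast
  hence v: "v \<in> carrier_vec d" "v \<noteq> 0\<^sub>v d" "A *\<^sub>v v = l \<cdot>\<^sub>v v"
    using A by (simp_all add: eigenvector_def)
  define W where "W = {w \<in> carrier_vec d. A *\<^sub>v w = l \<cdot>\<^sub>v w}"
  have "W = {0\<^sub>v d} \<or> W = carrier_vec d"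
  proof (rule irreducible_representationD[OF irr])
    fix g w assume g: "g \<in> carrier G" and w: "w \<in> W"
    note R = matrix_representation_carrier[OF rep g]
    have wd: "w \<in> carrier_vec d" and Aw: "A *\<^sub>v w = l \<cdot>\<^sub>v w" using w by (simp_all add: W_def)
    have "A *\<^sub>v (\<rho> g *\<^sub>v w) = (A * \<rho> g) *\<^sub>v w"
      by (rule assoc_mult_mat_vec[OF A R wd, symmetric])
    also have "\<dots> = \<rho> g *\<^sub>v (A *\<^sub>v w)"
      unfolding comm[OF g, symmetric] by (rule assoc_mult_mat_vec[OF R A wd])
    also have "\<dots> = l \<cdot>\<^sub>v (\<rho> g *\<^sub>v w)" unfolding Aw by (rule mult_mat_vec[OF R wd])
    finally show "\<rho> g *\<^sub>v w \<in> W" using R wd unfolding W_def by simp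
  next
    fix a w assume "w \<in> W"
    thus "a \<cdot>\<^sub>v w \<in> W"
      by (simp add: W_def mult_mat_vec[OF A] smult_smult_assoc mult.commute)
  qed (use A in \<open>auto simp: W_def mult_add_distrib_mat_vec smult_add_distrib_vec\<close>)
  moreover have "v \<in> W" using v by (simp add: W_def)
  ultimately have W: "W = carrier_vec d" using v by auto
  have "A = l \<cdot>\<^sub>m 1\<^sub>m d"
  proof (rule eq_matI)
    fix i j assume "i < dim_row (l \<cdot>\<^sub>m 1\<^sub>m d)" "j < dim_col (l \<cdot>\<^sub>m 1\<^sub>m d)"
    hence ij: "i < d" "j < d" by auto
    have "unit_vec d j \<in> W" unfolding W by simp
    hence "(A *\<^sub>v unit_vec d j) $ i = (l \<cdot>\<^sub>v unit_vec d j) $ i" by (simp add: W_def)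
    thus "A $$ (i, j) = (l \<cdot>\<^sub>m 1\<^sub>m d) $$ (i, j)"
      using A ij by auto
  qed (use A in auto)
  thus ?thesis by (rule that)
qed

lemma trivial_irreducible_degree:
  assumes irr: "irreducible_representation G d \<rho>"
    and triv: "\<And>g. g \<in> carrier G \<Longrightarrow> \<rho> g = 1\<^sub>m d"
  shows "d = 1"
proof (rule ccontr)
  assume "d \<noteq> 1"
  moreover have "d \<noteq> 0" using irr by (simp add: irreducible_representation_def)
  ultimately have d: "d > 1" by simp
  \<comment> \<open>Every subspace is invariant under a trivial action. Indices start at 0, so
    coordinate 1 exists as \<open>d > 1\<close>; the unit vectors 0 and 1 show that \<open>W\<close>
    is nonzero and proper.\<close>
  define W :: "complex vec set" where "W = {w \<in> carrier_vec d. w $ 1 = 0}"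
  have "W = {0\<^sub>v d} \<or> W = carrier_vec d"
    by (rule irreducible_representationD[OF irr]) (use d in \<open>auto simp: W_def triv\<close>)
  moreover have "unit_vec d 0 \<in> W" using d by (simp add: W_def)
  moreover have "unit_vec d 0 \<noteq> (0\<^sub>v d :: complex vec)"
    using d by (intro unit_vec_nonzero) simp
  moreover have "unit_vec d 1 \<in> carrier_vec d" "unit_vec d 1 \<notin> W" using d by (auto simp: W_def)
  ultimately show False by blast
qed

section \<open>Averaging over a subgroup and defect zero\<close>

text \<open>Left translation by \<open>h\<close> permutes \<open>P\<close>, so the sum over
  \<open>P\<close> absorbs each factor \<open>\<rho> h\<close>. Its square is therefore
  \<open>card P\<close> times itself.\<close>

lemma subgroup_average_idempotent:
  fixes G (structure)
  assumes G: "group G" and rep: "matrix_representation G d \<rho>"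
    and P: "subgroup P G" "finite P"
  defines "E \<equiv> (1 / of_nat (card P)) \<cdot>\<^sub>m mat_sum d P \<rho>"
  shows "E * E = E"
proof -
  interpret group G by fact
  interpret subgroup P G by fact
  let ?M = "mat_sum d P \<rho>"
  note R = matrix_representation_carrier[OF rep]
  have card: "card P \<noteq> 0" using P(2) one_closed by (metis card_0_eq empty_iff)
  have "\<rho> h * ?M = ?M" if h: "h \<in> P" for h
  proof -
    have "bij_betw (\<lambda>g. h \<otimes> g) P P"
      by (rule bij_betwI[where g = "\<lambda>g. inv h \<otimes> g"]) (use h in \<open>auto simp: m_assoc[symmetric]\<close>)
    note reindex = mat_sum_reindex[OF this, of d \<rho>]
    have "\<rho> h * ?M = mat_sum d P (\<lambda>g. \<rho> h * \<rho> g)"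
      by (rule mult_mat_sum) (use h R in auto)
    also have "\<dots> = mat_sum d P (\<lambda>g. \<rho> (h \<otimes> g))"
      by (rule mat_sum_cong) (use h in \<open>simp add: matrix_representation_mult[OF rep]\<close>)
    finally show ?thesis unfolding reindex[symmetric] .
  qed
  hence "?M * ?M = of_nat (card P) \<cdot>\<^sub>m ?M"
    by (simp add: mat_sum_mult R mat_sum_const cong: mat_sum_cong)
  thus ?thesis using card
    by (simp add: E_def mult_smult_distrib[where nr=d and n=d and nc=d] mult_smult_assoc_mat[where nr=d and n=d and nc=d] smult_smult_mat)
qed

text \<open>Only the identity contributes to the trace of the average, which is thus
  \<open>d / card P\<close>. As the trace of an idempotent it is a natural number.\<close>

lemma card_subgroup_dvd_degree:
  fixes G (structure)
  assumes G: "group G" and rep: "matrix_representation G d \<rho>"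
    and P: "subgroup P G" "finite P"
    and zero: "\<And>g. g \<in> P \<Longrightarrow> g \<noteq> \<one> \<Longrightarrow> matrix_trace (\<rho> g) = 0"
  shows "card P dvd d"
proof -
  interpret group G by fact
  interpret subgroup P G by fact
  note R = matrix_representation_carrier[OF rep]
  let ?E = "(1 / of_nat (card P)) \<cdot>\<^sub>m mat_sum d P \<rho>"
  have card: "card P \<noteq> 0" using P(2) one_closed by (metis card_0_eq empty_iff)
  obtain k :: nat where k: "matrix_trace ?E = of_nat k"
    by (rule idempotent_trace[of ?E d]) (simp_all add: subgroup_average_idempotent[OF G rep P])
  have "matrix_trace (mat_sum d P \<rho>) = (\<Sum>g\<in>P. if g = \<one> then of_nat d else 0)"
    by (subst matrix_trace_mat_sum)
      (auto simp: R zero matrix_representation_one[OF G rep] intro!: sum.cong)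
  also have "\<dots> = of_nat d" using P by (simp add: one_closed)
  finally have "of_nat d / of_nat (card P) = (of_nat k :: complex)"
    using k by (simp add: matrix_trace_smult[where n = d])
  hence "of_nat d = (of_nat (k * card P) :: complex)" using card by (simp add: field_simps)
  hence "d = k * card P" unfolding of_nat_eq_iff .
  thus ?thesis by simp
qed

lemma vanishing_on_p_singular_imp_defect_zero:
  fixes G (structure)
  assumes G: "group G" "finite (carrier G)" and p: "prime p"
    and rep: "matrix_representation G d \<rho>" and d: "d \<noteq> 0"
    and chi: "\<And>g. g \<in> carrier G \<Longrightarrow> \<chi> g = matrix_trace (\<rho> g)"
    and zero: "\<And>g. p_singular p G g \<Longrightarrow> \<chi> g = 0"
  shows "p_defect_zero p G \<chi>"
  unfolding p_defect_zero_def
proof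
  interpret group G by fact
  assume "\<exists>k::int. of_nat (Coset.order G) / \<chi> \<one> = of_nat p * of_int k"
  then obtain k :: int where k: "of_nat (Coset.order G) / \<chi> \<one> = of_nat p * of_int k" by blast
  have ord0: "Coset.order G \<noteq> 0" using G by (auto simp: Coset.order_def)
  obtain a m where am: "Coset.order G = p ^ a * m" "\<not> p dvd m"
    using ord0 p by (metis multiplicity_decompose' not_prime_unit)
  obtain P where P: "subgroup P G" "card P = p ^ a"
    using sylow_thm[OF p G(1) am(1) G(2)] by blast
  interpret subgroup P G by fact
  have fin: "finite P" using G(2) finite_subset subset by blast
  have "matrix_trace (\<rho> g) = 0" if g: "g \<in> P" "g \<noteq> \<one>" for g
  proof -
    have gG: "g \<in> carrier G" using g by simp
    \<comment> \<open>Lagrange inside \<open>P\<close> makes the order of \<open>g\<close> a power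
      of \<open>p\<close>. It is not 1, so \<open>g\<close> is \<open>p\<close>-singular.\<close>
    interpret P: group "G\<lparr>carrier := P\<rparr>" by (rule subgroup_is_group) fact
    have "g [^]\<^bsub>G\<lparr>carrier := P\<rparr>\<^esub> Coset.order (G\<lparr>carrier := P\<rparr>) = \<one>"
      using P.pow_order_eq_1[of g] g by simp
    hence "g [^] (p ^ a) = \<one>"
      using nat_pow_consistent[of g "p ^ a" P] P(2) by (simp add: Coset.order_def)
    hence dvd: "ord g dvd p ^ a" using pow_eq_id[OF gG] by simp
    have "ord g \<noteq> 1" using g ord_eq_1[OF gG] by simp
    hence "p dvd ord g" using dvd p by (auto simp: divides_primepow_nat)
    hence "\<chi> g = 0" using zero gG by (simp add: p_singular_def)
    thus ?thesis using chi gG by simp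
  qed
  hence "p ^ a dvd d" using card_subgroup_dvd_degree[OF G(1) rep P(1) fin] P(2) by simp
  then obtain e where e: "d = p ^ a * e" by blast
  have "\<chi> \<one> = of_nat d" using chi by (simp add: matrix_representation_one[OF G(1) rep])
  with k d have "of_nat (Coset.order G) = (of_nat p * of_int k * of_nat d :: complex)"
    by (simp add: field_simps)
  hence "of_int (int (Coset.order G)) = (of_int (int p * k * int d) :: complex)" by simp
  hence "int (Coset.order G) = int p * k * int d" unfolding of_int_eq_iff .
  \<comment> \<open>The full power \<open>p ^ a\<close> of \<open>p\<close> in the group order
    already divides \<open>d\<close>; cancelling it leaves \<open>m\<close> as a multiple of
    \<open>p\<close>.\<close>
  hence "int (p ^ a) * int m = int (p ^ a) * (int p * k * int e)"
    unfolding am e by (simp add: algebra_simps)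
  hence "int m = int p * (k * int e)" using p by (auto simp: prime_gt_0_nat)
  hence "int p dvd int m" by simp
  with am(2) show False by simp
qed

section \<open>Symmetric groups\<close>

lemma transpose_in_sym_group:
  "a \<in> {1..n} \<Longrightarrow> b \<in> {1..n} \<Longrightarrow> transpose a b \<in> carrier (sym_group n)"
  by (simp add: sym_group_carrier permutes_swap_id)

text \<open>Transpositions generate the symmetric group; the induction multiplies by one
  transposition on the left.\<close>

lemma sym_group_trivial_if_transpose_trivial:
  assumes rep: "matrix_representation (sym_group n) d \<rho>"
    and triv: "\<And>a b. a \<in> {1..n} \<Longrightarrow> b \<in> {1..n} \<Longrightarrow> \<rho> (transpose a b) = 1\<^sub>m d"
    and g: "g \<in> carrier (sym_group n)"
  shows "\<rho> g = 1\<^sub>m d"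
proof -
  have "g permutes {1..n}" using g by (simp add: sym_group_carrier)
  thus ?thesis using finite_atLeastAtMost
  proof (induction rule: permutes_induct)
    case id
    show ?case using matrix_representation_one[OF sym_group_is_group rep] by (simp add: sym_group_one id_def)
  next
    case (swap a b q)
    have "\<rho> (transpose a b \<circ> q) = \<rho> (transpose a b) * \<rho> q"
      using matrix_representation_mult[OF rep transpose_in_sym_group[OF swap(1,2)], of q] swap
      unfolding sym_group_mult sym_group_carrier by blast
    also have "\<dots> = 1\<^sub>m d" using swap triv[OF swap(1,2)] by simp
    finally show ?case .
  qed
qed

text \<open>Conjugation by \<open>g\<close> sends the transposition of \<open>a, b\<close> to that
  of \<open>g a, g b\<close>. Summing over the full square of ordered pairs makes this a reindexing
  by \<open>map_prod g g\<close>; each proper transposition occurs twice and the identity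
  \<open>n\<close> times.\<close>

lemma transposition_sum_central:
  assumes rep: "matrix_representation (sym_group n) d \<rho>" and g: "g \<in> carrier (sym_group n)"
  defines "M \<equiv> mat_sum d ({1..n} \<times> {1..n}) (\<lambda>(a, b). \<rho> (transpose a b))"
  shows "\<rho> g * M = M * \<rho> g"
proof -
  let ?S = "{1..n} \<times> {1..n}"
  note R = matrix_representation_carrier[OF rep]
  have gp: "g permutes {1..n}" using g by (simp add: sym_group_carrier)
  have conj: "g \<circ> transpose a b = transpose (g a) (g b) \<circ> g" for a b
    using transpose_comp_eq[OF permutes_bij[OF gp], of "g a" "g b"]
    by (simp add: permutes_inverses[OF gp])
  have bij: "bij_betw (map_prod g g) ?S ?S"
    by (intro bij_betw_map_prod permutes_imp_bij gp)
  have g_in: "g a \<in> {1..n}" if "a \<in> {1..n}" for a using permutes_in_image[OF gp] that by blast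
  have "\<rho> g * M = mat_sum d ?S (\<lambda>(a, b). \<rho> g * \<rho> (transpose a b))"
    unfolding M_def using R[OF g]
    by (subst mult_mat_sum) (auto intro!: R transpose_in_sym_group mat_sum_cong)
  also have "\<dots> = mat_sum d ?S (\<lambda>(a, b). \<rho> (transpose (g a) (g b)) * \<rho> g)"
  proof (rule mat_sum_cong, clarify)
    fix a b assume ab: "a \<in> {1..n}" "b \<in> {1..n}"
    have "\<rho> g * \<rho> (transpose a b) = \<rho> (g \<circ> transpose a b)"
      using matrix_representation_mult[OF rep g transpose_in_sym_group[OF ab]]
      by (simp add: sym_group_mult)
    also have "\<dots> = \<rho> (transpose (g a) (g b)) * \<rho> g" unfolding conj
      using matrix_representation_mult[OF rep transpose_in_sym_group[OF g_in g_in] g, OF ab]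
      by (simp add: sym_group_mult)
    finally show "\<rho> g * \<rho> (transpose a b) = \<rho> (transpose (g a) (g b)) * \<rho> g" .
  qed
  also have "\<dots> = mat_sum d ?S (\<lambda>s. (\<lambda>(a, b). \<rho> (transpose a b) * \<rho> g) (map_prod g g s))"
    by (intro mat_sum_cong) auto
  also have "\<dots> = mat_sum d ?S (\<lambda>(a, b). \<rho> (transpose a b) * \<rho> g)"
    by (rule mat_sum_reindex[OF bij, symmetric])
  also have "\<dots> = M * \<rho> g"
    unfolding M_def using R[OF g]
    by (subst mat_sum_mult) (auto intro!: R transpose_in_sym_group mat_sum_cong)
  finally show ?thesis .
qed

text \<open>A permutation that raises some \<open>\<int>/p\<close>-valued label by one along an invariant set has all its
  cycle lengths on that set divisible by \<open>p\<close>.\<close>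

lemma p_singular_sym_groupI:
  fixes f :: "nat \<Rightarrow> int"
  assumes g: "g \<in> carrier (sym_group n)" and S: "s \<in> S"
    and step: "\<And>y. y \<in> S \<Longrightarrow> g y \<in> S \<and> int p dvd f (g y) - f y - 1"
  shows "p_singular p (sym_group n) g"
proof -
  interpret group "sym_group n" by (rule sym_group_is_group)
  have pow: "g [^]\<^bsub>sym_group n\<^esub> m = g ^^ m" for m :: nat
    by (induction m) (simp_all add: sym_group_one sym_group_mult funpow_Suc_right del: funpow.simps(2))
  have *: "(g ^^ m) s \<in> S \<and> int p dvd f ((g ^^ m) s) - f s - int m" for m
  proof (induction m)
    case 0
    thus ?case using S by simp
  next
    case (Suc m)
    from Suc step[of "(g ^^ m) s"] show ?case
      using dvd_add[of "int p" "f ((g ^^ m) s) - f s - int m" "f (g ((g ^^ m) s)) - f ((g ^^ m) s) - 1"]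
      by (simp add: algebra_simps)
  qed
  \<comment> \<open>After \<open>ord g\<close> steps the point is back at \<open>s\<close>, so the
    labels cancel and only \<open>ord g\<close> remains modulo \<open>p\<close>.\<close>
  have "g ^^ ord g = id" using pow_ord_eq_1[OF g] by (simp add: pow sym_group_one)
  with *[of "ord g"] have "int p dvd int (ord g)" by simp
  thus ?thesis using g by (simp add: p_singular_def)
qed

section \<open>Two disjoint p-cycles multiplied by a transposition\<close>

text \<open>This is the product of the cycles \<open>(1 ... p)\<close> and
  \<open>(p+1 ... 2p)\<close>; all other numbers, including 0, are fixed.\<close>

definition two_cycles :: "nat \<Rightarrow> nat \<Rightarrow> nat" where
  "two_cycles p i = (if i = p then 1 else if i = 2 * p then p + 1
     else if 1 \<le> i \<and> i < 2 * p then i + 1 else i)"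

lemma two_cycles_in_sym_group:
  assumes "p \<ge> 1" "n \<ge> 2 * p"
  shows "two_cycles p \<in> carrier (sym_group n)"
proof -
  have "inj_on (two_cycles p) {1..n}"
    using assms by (auto simp: inj_on_def two_cycles_def split: if_splits)
  moreover have sub: "two_cycles p ` {1..n} \<subseteq> {1..n}"
    using assms by (auto simp: two_cycles_def)
  ultimately have "bij_betw (two_cycles p) {1..n} {1..n}"
    by (simp add: bij_betw_def endo_inj_surj)
  thus ?thesis unfolding sym_group_carrier
    by (rule bij_imp_permutes) (use assms in \<open>auto simp: two_cycles_def\<close>)
qed

text \<open>At the ends \<open>p\<close> and \<open>2 * p\<close> the value wraps around by
  \<open>p\<close>, so modulo \<open>p\<close> it is \<open>y + 1\<close> throughout. Hence
  \<open>y\<close> itself serves as the label on either cycle.\<close>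

lemma two_cycles_step:
  assumes "y \<in> {1..p} \<or> y \<in> {p+1..2*p}"
  shows "(two_cycles p y \<le> p \<longleftrightarrow> y \<le> p) \<and> two_cycles p y \<in> {1..2*p} \<and>
    int p dvd int (two_cycles p y) - int y - 1"
proof -
  consider "y = p" | "y = 2 * p" | "y \<noteq> p" "y \<noteq> 2 * p" by blast
  thus ?thesis using assms by cases (auto simp: two_cycles_def)
qed

lemma two_cycles_comp_transpose_p_singular:
  assumes p: "p \<ge> 2" and n: "n \<ge> 2 * p" and ab: "a \<in> {1..n}" "b \<in> {1..n}"
  shows "p_singular p (sym_group n) (two_cycles p \<circ> transpose a b)"
proof -
  let ?x = "two_cycles p" and ?g = "two_cycles p \<circ> transpose a b"
  interpret group "sym_group n" by (rule sym_group_is_group)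
  have g: "?g \<in> carrier (sym_group n)"
    using m_closed[OF two_cycles_in_sym_group[of p n] transpose_in_sym_group[OF ab]] p n
    unfolding sym_group_mult by linarith
  have merge: "p_singular p (sym_group n) (two_cycles p \<circ> transpose u v)"
    if uv: "1 \<le> u" "u \<le> p" "p < v" "v \<le> 2 * p"
      and g: "two_cycles p \<circ> transpose u v \<in> carrier (sym_group n)" for u v
  proof -
    \<comment> \<open>The labels of the two cycles are shifted so that those of \<open>u\<close> and \<open>v\<close> agree.\<close>
    define f where "f y = (if y \<le> p then int y - int u else int y - int v)" for y
    show ?thesis
    proof (rule p_singular_sym_groupI[OF g, where s = 1 and S = "{1..2*p}" and f = f])
      fix y assume y: "y \<in> {1..2*p}"
      let ?z = "transpose u v y"
      \<comment> \<open>Since \<open>f u = f v = 0\<close>, the transposition does not change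
        labels. Then \<open>?x\<close> stays within one cycle, where the shift cancels from the
        difference.\<close>
      have z: "?z \<in> {1..2*p}" "f ?z = f y" using y uv by (auto simp: transpose_def f_def)
      have "?z \<in> {1..p} \<or> ?z \<in> {p+1..2*p}" using z(1) by auto
      note step = two_cycles_step[OF this]
      hence "f (?x ?z) - f ?z = int (?x ?z) - int ?z" by (simp add: f_def)
      with step z(2) show "(?x \<circ> transpose u v) y \<in> {1..2*p} \<and>
          int p dvd f ((?x \<circ> transpose u v) y) - f y - 1" by simp
    qed (use p in auto)
  qed
  \<comment> \<open>Either the transposition avoids one of the cycles, which then survives, or it
    has one point in each and merges them.\<close>
  have "(a \<notin> {1..p} \<and> b \<notin> {1..p}) \<or> (a \<notin> {p+1..2*p} \<and> b \<notin> {p+1..2*p}) \<or>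
      (a \<in> {1..p} \<and> b \<in> {p+1..2*p}) \<or> (b \<in> {1..p} \<and> a \<in> {p+1..2*p})"
    using ab by (cases "a \<le> p"; cases "b \<le> p") auto
  then consider "a \<notin> {1..p}" "b \<notin> {1..p}" | "a \<notin> {p+1..2*p}" "b \<notin> {p+1..2*p}"
    | "a \<in> {1..p}" "b \<in> {p+1..2*p}" | "b \<in> {1..p}" "a \<in> {p+1..2*p}"
    by blast
  thus ?thesis
  proof cases
    case 1
    show ?thesis
    proof (rule p_singular_sym_groupI[OF g, where s = "1" and S = "{1..p}" and f = int])
      fix y assume y: "y \<in> {1..p}"
      hence "transpose a b y = y" using 1 by (intro transpose_apply_other) auto
      moreover have "y \<in> {1..p} \<or> y \<in> {p+1..2*p}" using y by blast
      note two_cycles_step[OF this]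
      ultimately show "?g y \<in> {1..p} \<and> int p dvd int (?g y) - int y - 1" using y by auto
    qed (use p in auto)
  next
    case 2
    show ?thesis
    proof (rule p_singular_sym_groupI[OF g, where s = "2*p" and S = "{p+1..2*p}" and f = int])
      fix y assume y: "y \<in> {p+1..2*p}"
      hence "transpose a b y = y" using 2 by (intro transpose_apply_other) auto
      moreover have "y \<in> {1..p} \<or> y \<in> {p+1..2*p}" using y by blast
      note two_cycles_step[OF this]
      ultimately show "?g y \<in> {p+1..2*p} \<and> int p dvd int (?g y) - int y - 1" using y by auto
    qed (use p in auto)
  next
    case 3
    thus ?thesis using merge[of a b] g by auto
  next
    case 4
    thus ?thesis using merge[of b a] g by (auto simp: transpose_commute)
  qed
qed

text \<open>Each \<open>E a b\<close> projects onto the eigenspace of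
  \<open>\<rho> (transpose a b)\<close> for -1. The hypothesis says that the traces of these
  projections sum to 0; being natural numbers they all vanish, and so do the projections.\<close>

lemma transposition_trivial_if_trace_sum:
  assumes rep: "matrix_representation (sym_group n) d \<rho>"
    and sum: "(\<Sum>(a, b)\<in>{1..n} \<times> {1..n}. matrix_trace (\<rho> (transpose a b))) = of_nat (n * n * d)"
    and ab: "a \<in> {1..n}" "b \<in> {1..n}"
  shows "\<rho> (transpose a b) = 1\<^sub>m d"
proof -
  let ?S = "{1..n} \<times> {1..n}"
  define E where "E a b = (1 / 2) \<cdot>\<^sub>m (1\<^sub>m d - \<rho> (transpose a b))" for a b
  note R = matrix_representation_carrier[OF rep transpose_in_sym_group]
  have E: "E a b \<in> carrier_mat d d" if "a \<in> {1..n}" "b \<in> {1..n}" for a b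
    using R[OF that] by (simp add: E_def minus_carrier_mat)
  have idem: "E a b * E a b = E a b" if ab: "a \<in> {1..n}" "b \<in> {1..n}" for a b
  proof -
    let ?T = "\<rho> (transpose a b)"
    have TT: "?T * ?T = 1\<^sub>m d"
      using matrix_representation_mult[OF rep transpose_in_sym_group transpose_in_sym_group, OF ab ab]
        matrix_representation_one[OF sym_group_is_group rep]
      by (simp add: sym_group_mult sym_group_one)
    have "(1\<^sub>m d - ?T) * (1\<^sub>m d - ?T) = (1\<^sub>m d - ?T) - (?T - ?T * ?T)"
      using R[OF ab]
      by (simp add: minus_mult_distrib_mat[where nr=d and n=d and nc=d]
          mult_minus_distrib_mat[where nr=d and n=d and nc=d] minus_carrier_mat)
    also have "\<dots> = 2 \<cdot>\<^sub>m (1\<^sub>m d - ?T)" unfolding TT using R[OF ab] by (intro eq_matI) auto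
    finally show ?thesis using R[OF ab]
      by (simp add: E_def mult_smult_distrib[where nr=d and n=d and nc=d]
          mult_smult_assoc_mat[where nr=d and n=d and nc=d] minus_carrier_mat smult_smult_mat)
  qed
  have "\<exists>k::nat. matrix_trace (E a b) = of_nat k \<and> (k = 0 \<longrightarrow> E a b = 0\<^sub>m d d)"
    if "a \<in> {1..n}" "b \<in> {1..n}" for a b
    using idempotent_trace[OF E[OF that] idem[OF that]] by metis
  then obtain k :: "nat \<Rightarrow> nat \<Rightarrow> nat" where k: "\<And>a b. a \<in> {1..n} \<Longrightarrow> b \<in> {1..n} \<Longrightarrow>
      matrix_trace (E a b) = of_nat (k a b) \<and> (k a b = 0 \<longrightarrow> E a b = 0\<^sub>m d d)"
    by metis
  have "(of_nat (\<Sum>(a, b)\<in>?S. k a b) :: complex) = (\<Sum>(a, b)\<in>?S. matrix_trace (E a b))"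
    using k by (auto intro!: sum.cong)
  also have "\<dots> = (\<Sum>(a, b)\<in>?S. (1 / 2) * (of_nat d - matrix_trace (\<rho> (transpose a b))))"
    using R by (auto simp: E_def matrix_trace_smult[where n = d] minus_carrier_mat matrix_trace_minus[where n = d] intro!: sum.cong)
  also have "\<dots> = (1 / 2) * ((\<Sum>(a, b)\<in>?S. of_nat d) - (\<Sum>(a, b)\<in>?S. matrix_trace (\<rho> (transpose a b))))"
    by (simp add: sum_subtractf sum_distrib_left case_prod_unfold right_diff_distrib)
  also have "\<dots> = 0" unfolding sum by (simp add: case_prod_unfold)
  finally have "(\<Sum>(a, b)\<in>?S. k a b) = 0" by (simp only: of_nat_eq_0_iff)
  hence "k a b = 0" using ab by auto
  hence "E a b = 0\<^sub>m d d" using k ab by blast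
  show ?thesis
  proof (rule eq_matI)
    fix i j assume "i < dim_row (1\<^sub>m d :: complex mat)" "j < dim_col (1\<^sub>m d :: complex mat)"
    moreover from this have "E a b $$ (i, j) = 0" using \<open>E a b = 0\<^sub>m d d\<close> by simp
    ultimately show "\<rho> (transpose a b) $$ (i, j) = 1\<^sub>m d $$ (i, j)"
      using R[OF ab] by (simp add: E_def)
  qed (use R[OF ab] in auto)
qed

section \<open>Vanishing of the character on p-singular elements\<close>

theorem proposition3p4:
  fixes p n :: nat and \<chi> :: "(nat \<Rightarrow> nat) \<Rightarrow> complex"
  assumes "prime p"
    and "n \<ge> 2 * p" and "2 * p \<ge> 4"
    and "irreducible_character (sym_group n) \<chi>"
    and "\<not> linear_character (sym_group n) \<chi>"
    and "p_constant p (sym_group n) \<chi>"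
  shows "p_defect_zero p (sym_group n) \<chi>"
proof -
  let ?G = "sym_group n" and ?x = "two_cycles p" and ?S = "{1..n} \<times> {1..n}"
  obtain d \<rho> where irr: "irreducible_representation ?G d \<rho>"
    and chi: "\<And>g. g \<in> carrier ?G \<Longrightarrow> \<chi> g = matrix_trace (\<rho> g)"
    using assms(4) by (auto simp: irreducible_character_def)
  have rep: "matrix_representation ?G d \<rho>" and d: "d \<noteq> 0"
    using irr by (auto simp: irreducible_representation_def)
  note R = matrix_representation_carrier[OF rep]
  interpret group ?G by (rule sym_group_is_group)
  have p: "p \<ge> 2" using assms(3) by simp
  have x: "?x \<in> carrier ?G" using two_cycles_in_sym_group p assms(2) by simp
  have sing: "p_singular p ?G (?x \<circ> transpose a b)" if "a \<in> {1..n}" "b \<in> {1..n}" for a b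
    by (rule two_cycles_comp_transpose_p_singular[OF p assms(2) that])
  \<comment> \<open>The pair \<open>(1, 1)\<close> gives the identity, so \<open>?x\<close> itself
    is \<open>p\<close>-singular and \<open>\<chi> ?x\<close> is the common value.\<close>
  have "1 \<in> {1..n}" using p assms(2) by simp
  from sing[OF this this] have "p_singular p ?G ?x" by simp
  hence const: "\<chi> g = \<chi> ?x" if "p_singular p ?G g" for g
    using assms(6) that unfolding p_constant_def by blast
  define M where "M = mat_sum d ?S (\<lambda>(a, b). \<rho> (transpose a b))"
  obtain l where l: "M = l \<cdot>\<^sub>m 1\<^sub>m d"
    using schur_scalar[OF irr, of M] transposition_sum_central[OF rep] by (auto simp: M_def)
  have "\<chi> ?x = 0"
  proof (rule ccontr)
    assume nz: "\<chi> ?x \<noteq> 0"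
    \<comment> \<open>The trace of \<open>\<rho> ?x * M\<close> is computed twice: termwise, where
      each of the \<open>n * n\<close> terms is \<open>\<chi> ?x\<close>, and from the scalar
      \<open>l\<close>. Cancelling \<open>\<chi> ?x\<close> gives \<open>l = n * n\<close>.\<close>
    have "\<rho> ?x * M = mat_sum d ?S (\<lambda>(a, b). \<rho> ?x * \<rho> (transpose a b))"
      unfolding M_def using R[OF x]
      by (subst mult_mat_sum) (auto intro!: R transpose_in_sym_group mat_sum_cong)
    hence "matrix_trace (\<rho> ?x * M) = (\<Sum>(a, b)\<in>?S. matrix_trace (\<rho> ?x * \<rho> (transpose a b)))"
      using R[OF x]
      by (simp, subst matrix_trace_mat_sum)
        (auto simp: case_prod_unfold intro!: mult_carrier_mat[of _ d d] R transpose_in_sym_group)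
    also have "\<dots> = (\<Sum>(a, b)\<in>?S. \<chi> ?x)"
    proof (rule sum.cong, simp, clarify)
      fix a b assume ab: "a \<in> {1..n}" "b \<in> {1..n}"
      have "matrix_trace (\<rho> ?x * \<rho> (transpose a b)) = \<chi> (?x \<circ> transpose a b)"
        using matrix_representation_mult[OF rep x transpose_in_sym_group[OF ab]] sing[OF ab] chi
        by (simp add: sym_group_mult p_singular_def)
      thus "matrix_trace (\<rho> ?x * \<rho> (transpose a b)) = \<chi> ?x"
        using const[OF sing[OF ab]] by (rule trans)
    qed
    finally have "matrix_trace (\<rho> ?x * M) = of_nat (n * n) * \<chi> ?x" by (simp add: case_prod_unfold)
    moreover have "\<rho> ?x * M = l \<cdot>\<^sub>m \<rho> ?x"
      unfolding l using R[OF x] by (simp add: mult_smult_distrib[OF R[OF x] one_carrier_mat])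
    ultimately have "l = of_nat (n * n)" using nz chi[OF x] R[OF x] by (simp add: matrix_trace_smult[where n = d])
    hence "matrix_trace M = of_nat (n * n * d)" by (simp add: l matrix_trace_smult[where n = d])
    moreover have "matrix_trace M = (\<Sum>(a, b)\<in>?S. matrix_trace (\<rho> (transpose a b)))"
      unfolding M_def
      by (subst matrix_trace_mat_sum) (auto simp: case_prod_unfold intro!: R transpose_in_sym_group)
    ultimately have "\<rho> g = 1\<^sub>m d" if "g \<in> carrier ?G" for g
      using sym_group_trivial_if_transpose_trivial[OF rep _ that]
        transposition_trivial_if_trace_sum[OF rep] by metis
    hence "d = 1" using trivial_irreducible_degree[OF irr] by blast
    hence "\<chi> \<one>\<^bsub>?G\<^esub> = 1" using chi by (simp add: matrix_representation_one[OF sym_group_is_group rep])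
    with assms(4,5) show False by (simp add: linear_character_def)
  qed
  hence zero: "\<chi> g = 0" if "p_singular p ?G g" for g
    using const[OF that] by simp
  have fin: "finite (carrier ?G)"
    using finite_permutations[of "{1..n}"] by (simp add: sym_group_def)
  show ?thesis
    by (rule vanishing_on_p_singular_imp_defect_zero[OF sym_group_is_group fin assms(1) rep d chi zero])
qed

end
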